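(* Let $C$ be a normal closed cone with nonempty interior $C^\circ$ in a real Banach space $X$ and let $f\colon C^\circ\to C^\circ$ be a fixed point free order-preserving homogeneous mapping, with $r_{C^\circ}(f)=1$, having converging approximate eigenvectors. Let $q\colon C^\circ\to(0,\infty)$ be a continuous homogeneous function such that $\Sigma^\circ=\{x\in C^\circ\colon q(x)=1\}$ is bounded in the norm topology, and let $g\colon\Sigma^\circ\to\Sigma^\circ$ be given by $g(x)=\frac{f(x)}{q(f(x))}$. If there exists $x_0\in C^\circ$ such that $\lim_{k\to\infty}\|f^k(x_0)\|=\infty$ and the orbit $\mathcal{O}(x_0/q(x_0);g)$ has compact closure in the norm topology of $X$, then there exists a convex set $\Omega\subseteq\partial C$ such that $\omega(z;g)\subseteq\Omega$ for all $z\in\Sigma^\circ$.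
   Context: A cone $C\subseteq X$ is a convex set with $C\cap(-C)=\{0\}$ and $\lambda C\subseteq C$ for all $\lambda\ge0$; $x\le_C y$ means $y-x\in C$. $C$ is normal if there is $\kappa\ge0$ with $\|x\|\le\kappa\|y\|$ whenever $0\le_C x\le_C y$. $f$ is order-preserving if $x\le_C y$ implies $f(x)\le_C f(y)$; homogeneous means $f(\lambda x)=\lambda f(x)$ (resp. $q(\lambda x)=\lambda q(x)$) for all $\lambda>0$; $q$ is continuous for the norm topology. The partial spectral radius is $r_{C^\circ}(f)=\lim_{k\to\infty}\|f^k\|_{C^\circ}^{1/k}$ with $\|f^k\|_{C^\circ}=\sup\{\|f^k(x)\|\colon x\in C^\circ,\|x\|\le1\}$. Approximate eigenvectors: fix a norm $|\cdot|$ on $X$ equivalent to $\|\cdot\|$ which is monotone ($|x|\le|y|$ whenever $0\le_C x\le_C y$); such a norm exists as $C$ is normal. Fix $u\in C^\circ$ with $\|u\|=1$. For $\epsilon>0$ the map $f_{\epsilon,u}(x)=f(x)+\epsilon|x|u$ on $C^\circ$ has a unique eigenvector $v_{\epsilon,u}\in C^\circ$ with $|v_{\epsilon,u}|=1$. We say that $f$ has converging approximate eigenvectors if there is a sequence $\epsilon_n\to0^+$ such that $(v_{\epsilon_n,u})_n$ converges in the norm topology. For a self-map $h$, $\mathcal{O}(x;h)=\{h^k(x)\colon k\ge0\}$ and $\omega(x;h)$ is the set of limits in the norm topology of subsequences $(h^{k_i}(x))_i$ with $k_i\to\infty$. *)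

theory Defs
  imports "HOL-Analysis.Analysis"
begin

definition ordering_cone :: "'a::real_vector set \<Rightarrow> bool" where
  "ordering_cone C \<longleftrightarrow> convex C \<and> C \<inter> uminus ` C = {0} \<and> cone C"

definition cone_le :: "'a::real_vector set \<Rightarrow> 'a \<Rightarrow> 'a \<Rightarrow> bool" where
  "cone_le C x y \<longleftrightarrow> y - x \<in> C"

definition normal_cone :: "'a::real_normed_vector set \<Rightarrow> bool" where
  "normal_cone C \<longleftrightarrow>
     (\<exists>\<kappa>\<ge>0. \<forall>x y. cone_le C 0 x \<and> cone_le C x y \<longrightarrow> norm x \<le> \<kappa> * norm y)"

definition homogeneous_on :: "'a::real_vector set \<Rightarrow> ('a \<Rightarrow> 'b::real_vector) \<Rightarrow> bool" where
  "homogeneous_on S h \<longleftrightarrow> (\<forall>x\<in>S. \<forall>c>0. h (c *\<^sub>R x) = c *\<^sub>R h x)"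

text \<open>
  The supremum is over a bounded set of reals whenever \<open>h\<close> is an order-preserving homogeneous
  self-map of the interior of a normal cone \<open>C\<close>, so the real-valued \<open>SUP\<close> is the true supremum.
\<close>

definition interior_norm :: "'a::real_normed_vector set \<Rightarrow> ('a \<Rightarrow> 'a) \<Rightarrow> real" where
  "interior_norm C h = (SUP x\<in>{x \<in> interior C. norm x \<le> 1}. norm (h x))"

definition has_partial_spectral_radius ::
    "'a::real_normed_vector set \<Rightarrow> ('a \<Rightarrow> 'a) \<Rightarrow> real \<Rightarrow> bool" where
  "has_partial_spectral_radius C f r \<longleftrightarrow>
     (\<lambda>k. interior_norm C (f ^^ k) powr (1 / real k)) \<longlonglongrightarrow> r"

definition equivalent_norm :: "('a::real_normed_vector \<Rightarrow> real) \<Rightarrow> bool" where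
  "equivalent_norm N \<longleftrightarrow>
     (\<forall>x. N x = 0 \<longleftrightarrow> x = 0) \<and>
     (\<forall>x y. N (x + y) \<le> N x + N y) \<and>
     (\<forall>c x. N (c *\<^sub>R x) = \<bar>c\<bar> * N x) \<and>
     (\<exists>a>0. \<exists>b>0. \<forall>x. a * norm x \<le> N x \<and> N x \<le> b * norm x)"

definition monotone_norm :: "'a::real_normed_vector set \<Rightarrow> ('a \<Rightarrow> real) \<Rightarrow> bool" where
  "monotone_norm C N \<longleftrightarrow> (\<forall>x y. cone_le C 0 x \<and> cone_le C x y \<longrightarrow> N x \<le> N y)"

definition perturbed_map ::
    "('a::real_normed_vector \<Rightarrow> real) \<Rightarrow> 'a \<Rightarrow> ('a \<Rightarrow> 'a) \<Rightarrow> real \<Rightarrow> 'a \<Rightarrow> 'a" where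
  "perturbed_map N u f \<epsilon> x = f x + (\<epsilon> * N x) *\<^sub>R u"

text \<open>
  For \<open>\<epsilon> > 0\<close> exactly one \<open>v\<close> satisfies the following predicate under the standing assumptions on
  \<open>C\<close>, \<open>N\<close>, \<open>u\<close> and \<open>f\<close>, so it is used as a relation instead of through a definite description.
\<close>

definition approx_eigenvector ::
    "'a::real_normed_vector set \<Rightarrow> ('a \<Rightarrow> real) \<Rightarrow> 'a \<Rightarrow> ('a \<Rightarrow> 'a) \<Rightarrow> real \<Rightarrow> 'a \<Rightarrow> bool" where
  "approx_eigenvector C N u f \<epsilon> v \<longleftrightarrow>
     v \<in> interior C \<and> N v = 1 \<and> (\<exists>\<mu>. perturbed_map N u f \<epsilon> v = \<mu> *\<^sub>R v)"

definition converging_approx_eigenvectors ::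
    "'a::real_normed_vector set \<Rightarrow> ('a \<Rightarrow> real) \<Rightarrow> 'a \<Rightarrow> ('a \<Rightarrow> 'a) \<Rightarrow> bool" where
  "converging_approx_eigenvectors C N u f \<longleftrightarrow>
     (\<exists>\<epsilon> v. (\<forall>n. \<epsilon> n > 0) \<and> \<epsilon> \<longlonglongrightarrow> 0 \<and>
        (\<forall>n::nat. approx_eigenvector C N u f (\<epsilon> n) (v n)) \<and> convergent v)"

definition forward_orbit :: "('a \<Rightarrow> 'a) \<Rightarrow> 'a \<Rightarrow> 'a set" where
  "forward_orbit h x = range (\<lambda>k. (h ^^ k) x)"

definition omega_limit :: "('a::topological_space \<Rightarrow> 'a) \<Rightarrow> 'a \<Rightarrow> 'a set" where
  "omega_limit h x = {y. \<exists>k. strict_mono k \<and> (\<lambda>i. (h ^^ k i) x) \<longlonglongrightarrow> y}"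

end

theory Submission
  imports Defs
begin

text \<open>
  Let \<open>v\<^sub>n\<close> be approximate eigenvectors, so that \<open>f v\<^sub>n + \<epsilon>\<^sub>n u = \<mu>\<^sub>n v\<^sub>n\<close> and hence
  \<open>f v\<^sub>n \<le> \<mu>\<^sub>n v\<^sub>n\<close>. Since the partial spectral radius is \<open>1\<close>, the limit superior of the \<open>\<mu>\<^sub>n\<close> is at
  most \<open>1\<close> (\<open>eventually_eigenvalue_le\<close>): for fixed \<open>k\<close> the \<open>k\<close>-th iterate of the perturbed map
  exceeds \<open>f\<^sup>k\<close> at \<open>u\<close> by a factor that tends to \<open>1\<close>.

  Rescale \<open>v\<^sub>n\<close> to \<open>w\<^sub>n = c\<^sub>n v\<^sub>n\<close>, where \<open>c\<^sub>n\<close> is least with \<open>u \<le> c\<^sub>n v\<^sub>n\<close>, and let \<open>\<Omega>\<close> consist of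
  those \<open>y\<close> in \<open>C\<close> such that, for every \<open>\<delta> > 0\<close>, eventually \<open>y \<le> \<delta> w\<^sub>n\<close>. It is the zero set in \<open>C\<close> of
  the horofunction-like sublinear functional \<open>y \<mapsto> limsup M(y / v\<^sub>n) / M(u / v\<^sub>n)\<close> with
  \<open>M(x / v) = inf {t. x \<le> t v}\<close>. It is convex, and it misses the interior because no multiple
  \<open>s u\<close> with \<open>s > 1\<close> lies below \<open>w\<^sub>n\<close>. If \<open>z \<le> b u\<close>, then \<open>f\<^sup>k z \<le> b \<mu>\<^sub>n\<^sup>k w\<^sub>n\<close>, so that
  \<open>g\<^sup>k z \<le> (b \<mu>\<^sub>n\<^sup>k / q (f\<^sup>k z)) w\<^sub>n\<close>. As \<open>k\<close> tends to infinity, \<open>q (f\<^sup>k z)\<close> does so too: the norm of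
  \<open>f\<^sup>k x\<^sub>0\<close>, hence by normality that of \<open>f\<^sup>k z\<close>, tends to infinity, and since \<open>\<Sigma>\<^sub>0\<close> is bounded, \<open>q\<close>
  dominates a multiple of the norm. Comparing a limit point of the orbit of \<open>z\<close> with a nearby
  \<open>g\<^sup>k z\<close> through the order unit \<open>u \<le> w\<^sub>n\<close> shows that it lies in \<open>\<Omega>\<close>.
\<close>

section \<open>The order of a closed cone\<close>

locale closed_ordering_cone =
  fixes C :: "'a::real_normed_vector set"
  assumes ordering_cone: "ordering_cone C" and closed_cone: "closed C"
begin

abbreviation le (infix "\<preceq>" 50) where "x \<preceq> y \<equiv> cone_le C x y"

lemma scaleR_mem: "x \<in> C \<Longrightarrow> 0 \<le> c \<Longrightarrow> c *\<^sub>R x \<in> C"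
  using ordering_cone by (auto simp: ordering_cone_def cone_def)

lemma add_mem: "x \<in> C \<Longrightarrow> y \<in> C \<Longrightarrow> x + y \<in> C"
  using ordering_cone convex_cone[of C] by (auto simp: ordering_cone_def)

lemma zero_mem: "0 \<in> C"
  using ordering_cone by (auto simp: ordering_cone_def)

lemma pointed: "x \<in> C \<Longrightarrow> - x \<in> C \<Longrightarrow> x = 0"
proof -
  assume "x \<in> C" "- x \<in> C"
  then have "x \<in> C \<inter> uminus ` C" by (auto intro: image_eqI[where x = "- x"])
  then show "x = 0" using ordering_cone by (auto simp: ordering_cone_def)
qed

lemma interior_mem: "x \<in> interior C \<Longrightarrow> x \<in> C"
  using interior_subset by blast

lemma interior_add_mem:
  assumes "x \<in> interior C" "y \<in> C"
  shows "x + y \<in> interior C"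
proof -
  have "open ((+) y ` interior C)" by (intro open_translation open_interior)
  moreover have "(+) y ` interior C \<subseteq> C" using assms(2) add_mem interior_mem by auto
  ultimately have "(+) y ` interior C \<subseteq> interior C" by (rule interior_maximal[rotated])
  then show ?thesis using assms(1) by (auto simp: add.commute)
qed

lemma interior_scaleR_mem:
  assumes "x \<in> interior C" "0 < c"
  shows "c *\<^sub>R x \<in> interior C"
proof -
  have "open ((*\<^sub>R) c ` interior C)" using assms(2) by (intro open_scaling open_interior) auto
  moreover have "(*\<^sub>R) c ` interior C \<subseteq> C" using assms(2) scaleR_mem interior_mem by auto
  ultimately have "(*\<^sub>R) c ` interior C \<subseteq> interior C" by (rule interior_maximal[rotated])
  then show ?thesis using assms(1) by auto
qed

lemma le_trans [trans]:
  assumes "x \<preceq> y" "y \<preceq> z"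
  shows "x \<preceq> z"
  using add_mem[of "y - x" "z - y"] assms by (simp add: cone_le_def)

lemma le_add: "x \<preceq> y \<Longrightarrow> a \<preceq> b \<Longrightarrow> x + a \<preceq> y + b"
  using add_mem[of "y - x" "b - a"] by (simp add: cone_le_def algebra_simps)

lemma le_refl: "x \<preceq> x"
  by (simp add: cone_le_def zero_mem)

lemma le_scaleR: "x \<preceq> y \<Longrightarrow> 0 \<le> c \<Longrightarrow> c *\<^sub>R x \<preceq> c *\<^sub>R y"
  using scaleR_mem[of "y - x" c] by (simp add: cone_le_def scaleR_diff_right)

lemma le_scaleR_left: "a \<le> b \<Longrightarrow> y \<in> C \<Longrightarrow> a *\<^sub>R y \<preceq> b *\<^sub>R y"
  using scaleR_mem[of y "b - a"] by (simp add: cone_le_def scaleR_diff_left)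

lemma zero_le: "x \<in> C \<Longrightarrow> 0 \<preceq> x"
  by (simp add: cone_le_def)

text \<open>Every interior point is an order unit, with constants that depend linearly on the norm.\<close>

lemma interior_order_unit:
  assumes "u \<in> interior C"
  obtains \<rho> where "\<rho> > 0" "\<And>x. x \<preceq> (norm x / \<rho>) *\<^sub>R u"
proof -
  obtain \<rho> where \<rho>: "\<rho> > 0" "cball u \<rho> \<subseteq> C"
    using assms mem_interior_cball by blast
  have "x \<preceq> (norm x / \<rho>) *\<^sub>R u" for x
  proof (cases "x = 0")
    case True
    then show ?thesis by (simp add: le_refl)
  next
    case False
    have "u - (\<rho> / norm x) *\<^sub>R x \<in> cball u \<rho>" using False \<rho>(1) by (simp add: dist_norm)
    then have "(norm x / \<rho>) *\<^sub>R (u - (\<rho> / norm x) *\<^sub>R x) \<in> C"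
      using \<rho> by (intro scaleR_mem) auto
    then show ?thesis using False \<rho>(1) by (simp add: cone_le_def scaleR_diff_right)
  qed
  with \<rho>(1) show thesis using that by blast
qed

lemma le_scaleR_interior:
  assumes "y \<in> interior C"
  obtains c where "c > 0" "x \<preceq> c *\<^sub>R y"
proof -
  obtain \<rho> where \<rho>: "\<rho> > 0" "\<And>x. x \<preceq> (norm x / \<rho>) *\<^sub>R y"
    using interior_order_unit[OF assms] by blast
  have "(norm x / \<rho>) *\<^sub>R y \<preceq> (norm x / \<rho> + 1) *\<^sub>R y"
    using assms by (intro le_scaleR_left interior_mem) auto
  then have "x \<preceq> (norm x / \<rho> + 1) *\<^sub>R y" using \<rho>(2) le_trans by blast
  moreover have "norm x / \<rho> + 1 > 0" using \<rho>(1) by (simp add: add_nonneg_pos)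
  ultimately show thesis using that by blast
qed

text \<open>The least factor is the value \<open>M(x / y)\<close> of the Funk gauge; it is attained as \<open>C\<close> is closed.\<close>

lemma least_dominating_factor:
  assumes "x \<in> C" "x \<noteq> 0" "y \<in> interior C"
  obtains c where "c > 0" "x \<preceq> c *\<^sub>R y" "\<And>t. x \<preceq> t *\<^sub>R y \<Longrightarrow> c \<le> t"
proof -
  define S where "S = {t. x \<preceq> t *\<^sub>R y}"
  have S_eq: "S = (\<lambda>t. t *\<^sub>R y - x) -` C" by (auto simp: S_def cone_le_def)
  have pos: "t > 0" if "t \<in> S" for t
  proof (rule ccontr)
    assume "\<not> t > 0"
    then have "(- t) *\<^sub>R y \<in> C" using assms(3) by (intro scaleR_mem interior_mem) auto
    moreover have "t *\<^sub>R y - x \<in> C" using that by (simp add: S_eq)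
    ultimately have "- x \<in> C" using add_mem by fastforce
    then show False using pointed assms by blast
  qed
  have "closed S" unfolding S_eq
    by (intro closed_vimage closed_cone continuous_intros)
  moreover have "S \<noteq> {}" using le_scaleR_interior[OF assms(3), of x] by (auto simp: S_def)
  moreover have bdd: "bdd_below S" using pos by (intro bdd_belowI[of _ 0]) (simp add: less_imp_le)
  ultimately have "Inf S \<in> S" by (intro closed_contains_Inf)
  moreover have "Inf S \<le> t" if "x \<preceq> t *\<^sub>R y" for t
    using that bdd by (intro cInf_lower) (auto simp: S_def)
  ultimately show thesis using that[of "Inf S"] pos by (auto simp: S_def)
qed

lemma zero_notin_interior:
  assumes "x \<in> C" "x \<noteq> 0"
  shows "0 \<notin> interior C"
proof
  assume "0 \<in> interior C"
  then obtain c where "x \<preceq> c *\<^sub>R 0" using le_scaleR_interior by blast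
  then show False using assms pointed by (simp add: cone_le_def)
qed

end

section \<open>Order-preserving homogeneous maps\<close>

locale homogeneous_monotone_map = closed_ordering_cone C
  for C :: "'a::real_normed_vector set" +
  fixes f :: "'a \<Rightarrow> 'a"
  assumes maps_interior: "f ` interior C \<subseteq> interior C"
    and monotone: "monotone_on (interior C) (cone_le C) (cone_le C) f"
    and homogeneous: "homogeneous_on (interior C) f"
begin

lemma funpow_interior: "x \<in> interior C \<Longrightarrow> (f ^^ k) x \<in> interior C"
  using maps_interior by (induction k) auto

lemma funpow_mono:
  assumes "x \<in> interior C" "y \<in> interior C" "x \<preceq> y"
  shows "(f ^^ k) x \<preceq> (f ^^ k) y"
proof (induction k)
  case (Suc k)
  then show ?case
    using monotone_onD[OF monotone funpow_interior[OF assms(1)] funpow_interior[OF assms(2)]]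
    by simp
qed (simp add: assms)

lemma funpow_scaleR:
  assumes "x \<in> interior C" "c > 0"
  shows "(f ^^ k) (c *\<^sub>R x) = c *\<^sub>R (f ^^ k) x"
proof (induction k)
  case (Suc k)
  then show ?case using homogeneous funpow_interior[OF assms(1)] assms(2)
    by (simp add: homogeneous_on_def)
qed simp

lemma funpow_le_scaleR:
  assumes "x \<in> interior C" "y \<in> interior C" "c > 0" "x \<preceq> c *\<^sub>R y"
  shows "(f ^^ k) x \<preceq> c *\<^sub>R (f ^^ k) y"
  using funpow_mono[of x "c *\<^sub>R y"] assms by (simp add: funpow_scaleR interior_scaleR_mem)

lemma funpow_supereigenvector:
  assumes "v \<in> interior C" "\<mu> > 0" "f v \<preceq> \<mu> *\<^sub>R v"
  shows "(f ^^ k) v \<preceq> \<mu> ^ k *\<^sub>R v"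
proof (induction k)
  case (Suc k)
  have "(f ^^ Suc k) v = (f ^^ k) (f v)" by (simp add: funpow_swap1)
  also have "\<dots> \<preceq> \<mu> *\<^sub>R (f ^^ k) v"
    using assms maps_interior by (intro funpow_le_scaleR) auto
  also have "\<dots> \<preceq> \<mu> *\<^sub>R (\<mu> ^ k *\<^sub>R v)" using Suc assms(2) by (intro le_scaleR) auto
  finally show ?case by simp
qed (simp add: le_refl)

lemma norm_funpow_le_interior_norm:
  assumes normal: "normal_cone C" and u: "u \<in> interior C" "norm u = 1"
  shows "norm ((f ^^ k) u) \<le> interior_norm C (f ^^ k)"
proof -
  obtain \<kappa> where \<kappa>: "\<kappa> \<ge> 0" "\<And>x y. 0 \<preceq> x \<Longrightarrow> x \<preceq> y \<Longrightarrow> norm x \<le> \<kappa> * norm y"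
    using normal by (auto simp: normal_cone_def)
  obtain \<rho> where \<rho>: "\<rho> > 0" "\<And>x. x \<preceq> (norm x / \<rho>) *\<^sub>R u"
    using interior_order_unit[OF u(1)] by blast
  have "norm ((f ^^ k) x) \<le> \<kappa> * norm ((1 / \<rho>) *\<^sub>R (f ^^ k) u)"
    if "x \<in> interior C" "norm x \<le> 1" for x
  proof (rule \<kappa>(2))
    show "0 \<preceq> (f ^^ k) x" using that by (intro zero_le interior_mem funpow_interior)
    have "(norm x / \<rho>) *\<^sub>R u \<preceq> (1 / \<rho>) *\<^sub>R u"
      using that \<rho>(1) u by (intro le_scaleR_left interior_mem divide_right_mono) auto
    then have "x \<preceq> (1 / \<rho>) *\<^sub>R u" using \<rho>(2) le_trans by blast
    then show "(f ^^ k) x \<preceq> (1 / \<rho>) *\<^sub>R (f ^^ k) u"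
      using that \<rho>(1) u by (intro funpow_le_scaleR) auto
  qed
  then have "bdd_above ((\<lambda>x. norm ((f ^^ k) x)) ` {x \<in> interior C. norm x \<le> 1})"
    by (auto intro!: bdd_aboveI2)
  then show ?thesis unfolding interior_norm_def by (rule cSUP_upper[rotated]) (use u in auto)
qed

text \<open>
  One power of \<open>(1 + \<eta>)\<^sup>k\<close> bounds the norm of \<open>f\<^sup>k u\<close>; the other absorbs the constant by which the
  norm dominates the order.
\<close>

lemma funpow_order_unit_le:
  assumes "normal_cone C" and u: "u \<in> interior C" "norm u = 1"
    and r: "has_partial_spectral_radius C f 1" and "\<eta> > 0"
  obtains k where "k > 0" "(f ^^ k) u \<preceq> ((1 + \<eta>) ^ k)\<^sup>2 *\<^sub>R u"
proof -
  obtain \<rho> where \<rho>: "\<rho> > 0" "\<And>x. x \<preceq> (norm x / \<rho>) *\<^sub>R u"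
    using interior_order_unit[OF u(1)] by blast
  let ?I = "\<lambda>k. interior_norm C (f ^^ k)"
  have "\<forall>\<^sub>F k in sequentially. ?I k powr (1 / real k) < 1 + \<eta>"
    using r \<open>\<eta> > 0\<close> unfolding has_partial_spectral_radius_def by (intro order_tendstoD) auto
  moreover have "\<forall>\<^sub>F k in sequentially. 1 / \<rho> \<le> (1 + \<eta>) ^ k"
  proof -
    obtain m where m: "1 / \<rho> < (1 + \<eta>) ^ m" using real_arch_pow[of "1 + \<eta>"] \<open>\<eta> > 0\<close> by auto
    have "1 / \<rho> \<le> (1 + \<eta>) ^ k" if "m \<le> k" for k
      using m power_increasing[OF that, of "1 + \<eta>"] \<open>\<eta> > 0\<close> by linarith
    then show ?thesis using eventually_sequentially by blast
  qed
  moreover have "\<forall>\<^sub>F k in sequentially. k > (0::nat)" by (rule eventually_gt_at_top)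
  ultimately have "\<forall>\<^sub>F k in sequentially. ?I k powr (1 / real k) < 1 + \<eta> \<and>
      1 / \<rho> \<le> (1 + \<eta>) ^ k \<and> k > 0"
    by eventually_elim auto
  then obtain k where k: "?I k powr (1 / real k) < 1 + \<eta>" "1 / \<rho> \<le> (1 + \<eta>) ^ k" "k > 0"
    by (auto simp: eventually_sequentially)
  have le: "norm ((f ^^ k) u) \<le> ?I k" using norm_funpow_le_interior_norm assms by blast
  then have nonneg: "?I k \<ge> 0" using norm_ge_zero order_trans by blast
  have "?I k = (?I k powr (1 / real k)) ^ k"
    using nonneg k(3) by (simp add: powr_powr flip: powr_realpow')
  also have "\<dots> \<le> (1 + \<eta>) ^ k" using k(1) by (intro power_mono) auto
  finally have "norm ((f ^^ k) u) \<le> (1 + \<eta>) ^ k" using le by simp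
  then have "norm ((f ^^ k) u) * (1 / \<rho>) \<le> (1 + \<eta>) ^ k * (1 + \<eta>) ^ k"
    using k(2) \<rho>(1) \<open>\<eta> > 0\<close> by (intro mult_mono) auto
  then have "(norm ((f ^^ k) u) / \<rho>) *\<^sub>R u \<preceq> ((1 + \<eta>) ^ k)\<^sup>2 *\<^sub>R u"
    using u by (intro le_scaleR_left interior_mem) (auto simp: power2_eq_square)
  then show thesis using that k(3) \<rho>(2) le_trans by blast
qed

section \<open>Eigenvalues of the perturbed maps\<close>

lemma perturbed_eigenvalue_pos:
  assumes u: "u \<in> interior C" "u \<noteq> 0" and v: "v \<in> interior C" "N v = 1"
    and "\<epsilon> > 0" and eig: "perturbed_map N u f \<epsilon> v = \<mu> *\<^sub>R v"
  shows "\<mu> > 0"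
proof (rule ccontr)
  assume "\<not> \<mu> > 0"
  then have neg: "(- \<mu>) *\<^sub>R v \<in> C" using v by (intro scaleR_mem interior_mem) auto
  have "f v + \<epsilon> *\<^sub>R u \<in> interior C"
    using maps_interior u v \<open>\<epsilon> > 0\<close> by (intro interior_add_mem scaleR_mem interior_mem) auto
  then have int: "\<mu> *\<^sub>R v \<in> interior C" using eig v by (simp add: perturbed_map_def)
  then have "\<mu> *\<^sub>R v = 0" using neg pointed interior_mem by fastforce
  then show False using int zero_notin_interior u interior_mem by metis
qed

text \<open>
  Each application of \<open>x \<mapsto> f x + \<epsilon> N(x) u\<close> costs at most a factor \<open>1 + \<epsilon> K\<close> compared with \<open>f\<close>
  along the first \<open>k\<close> points of the orbit of \<open>u\<close>.
\<close>

lemma perturbed_eigenvector_power_le: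
  assumes N: "equivalent_norm N" "monotone_norm C N"
    and u: "u \<in> interior C" and v: "v \<in> interior C"
    and eig: "perturbed_map N u f \<epsilon> v = \<mu> *\<^sub>R v" and "\<mu> > 0" "\<epsilon> > 0" "\<tau> > 0" "K \<ge> 0"
    and le: "v \<preceq> \<tau> *\<^sub>R u"
    and K: "\<And>i. i < k \<Longrightarrow> N ((f ^^ i) u) *\<^sub>R u \<preceq> K *\<^sub>R (f ^^ Suc i) u"
  shows "j \<le> k \<Longrightarrow> \<mu> ^ j *\<^sub>R v \<preceq> (\<tau> * (1 + \<epsilon> * K) ^ j) *\<^sub>R (f ^^ j) u"
proof (induction j)
  case 0
  then show ?case using le by simp
next
  case (Suc j)
  define s where "s = \<tau> * (1 + \<epsilon> * K) ^ j"
  have "1 + \<epsilon> * K > 0" using assms by (simp add: add_pos_nonneg)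
  then have s: "s > 0" using assms by (simp add: s_def)
  have IH: "\<mu> ^ j *\<^sub>R v \<preceq> s *\<^sub>R (f ^^ j) u" using Suc by (simp add: s_def)
  have N_scale: "N (c *\<^sub>R x) = c * N x" if "c \<ge> 0" for c x
    using N(1) that by (simp add: equivalent_norm_def)
  have mem: "\<mu> ^ j *\<^sub>R v \<in> interior C" "(f ^^ j) u \<in> interior C"
    using v u \<open>\<mu> > 0\<close> by (auto intro: interior_scaleR_mem funpow_interior)
  have "N (\<mu> ^ j *\<^sub>R v) \<le> N (s *\<^sub>R (f ^^ j) u)"
    using N(2) IH mem(1) zero_le interior_mem unfolding monotone_norm_def by blast
  then have N_le: "\<mu> ^ j * N v \<le> s * N ((f ^^ j) u)"
    using s \<open>\<mu> > 0\<close> by (simp add: N_scale)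
  have f_le: "f (\<mu> ^ j *\<^sub>R v) \<preceq> s *\<^sub>R f ((f ^^ j) u)"
    using funpow_le_scaleR[OF mem s IH, of 1] by simp
  have "f (\<mu> ^ j *\<^sub>R v) = \<mu> ^ j *\<^sub>R f v"
    using funpow_scaleR[OF v, of "\<mu> ^ j" 1] \<open>\<mu> > 0\<close> by simp
  then have "\<mu> ^ Suc j *\<^sub>R v = f (\<mu> ^ j *\<^sub>R v) + (\<epsilon> * (\<mu> ^ j * N v)) *\<^sub>R u"
    using arg_cong[OF eig, of "\<lambda>x. \<mu> ^ j *\<^sub>R x"]
    by (simp add: perturbed_map_def scaleR_add_right mult.commute mult.left_commute)
  also have "\<dots> \<preceq> s *\<^sub>R f ((f ^^ j) u) + (\<epsilon> * (s * N ((f ^^ j) u))) *\<^sub>R u"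
    using f_le N_le u \<open>\<epsilon> > 0\<close> by (intro le_add le_scaleR_left interior_mem mult_left_mono) auto
  also have "\<dots> = s *\<^sub>R f ((f ^^ j) u) + (\<epsilon> * s) *\<^sub>R (N ((f ^^ j) u) *\<^sub>R u)"
    by (simp add: mult.assoc)
  also have "\<dots> \<preceq> s *\<^sub>R f ((f ^^ j) u) + (\<epsilon> * s) *\<^sub>R (K *\<^sub>R (f ^^ Suc j) u)"
    using K[of j] Suc.prems s \<open>\<epsilon> > 0\<close> by (intro le_add le_refl le_scaleR) auto
  also have "\<dots> = (\<tau> * (1 + \<epsilon> * K) ^ Suc j) *\<^sub>R (f ^^ Suc j) u"
    by (simp add: s_def algebra_simps)
  finally show ?case .
qed

text \<open>
  The preceding bound at \<open>j = k\<close>, with \<open>\<tau>\<close> the least factor such that \<open>v \<le> \<tau> u\<close>, yields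
  \<open>\<mu>\<^sup>k v \<le> \<tau> \<theta> u\<close>, and minimality of \<open>\<tau>\<close> turns this into \<open>\<mu>\<^sup>k \<le> \<theta>\<close>.
\<close>

lemma eventually_eigenvalue_le:
  assumes normal: "normal_cone C" and N: "equivalent_norm N" "monotone_norm C N"
    and u: "u \<in> interior C" "norm u = 1"
    and r: "has_partial_spectral_radius C f 1"
    and \<epsilon>: "\<And>n. \<epsilon> n > 0" "\<epsilon> \<longlonglongrightarrow> 0"
    and v: "\<And>n. v n \<in> interior C"
    and eig: "\<And>n. perturbed_map N u f (\<epsilon> n) (v n) = \<mu> n *\<^sub>R v n" and pos: "\<And>n. \<mu> n > 0"
    and "a > 1"
  shows "\<forall>\<^sub>F n in sequentially. \<mu> n \<le> a"
proof -
  \<comment> \<open>Two factors \<open>1 + \<eta>\<close> come from \<open>f\<^sup>k u\<close> and one from the perturbation.\<close>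
  define \<eta> where "\<eta> = root 3 a - 1"
  have \<eta>: "\<eta> > 0" "(1 + \<eta>) ^ 3 = a" using \<open>a > 1\<close> by (auto simp: \<eta>_def)
  obtain k where k: "k > 0" "(f ^^ k) u \<preceq> ((1 + \<eta>) ^ k)\<^sup>2 *\<^sub>R u"
    using funpow_order_unit_le[OF normal u r \<eta>(1)] by blast
  have "\<exists>c>0. N ((f ^^ i) u) *\<^sub>R u \<preceq> c *\<^sub>R (f ^^ Suc i) u" for i
    using le_scaleR_interior[OF funpow_interior[OF u(1), of "Suc i"]] by blast
  then obtain c where c: "\<And>i. c i > 0" "\<And>i. N ((f ^^ i) u) *\<^sub>R u \<preceq> c i *\<^sub>R (f ^^ Suc i) u"
    by metis
  define K where "K = (\<Sum>i<k. c i)"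
  have K: "N ((f ^^ i) u) *\<^sub>R u \<preceq> K *\<^sub>R (f ^^ Suc i) u" if "i < k" for i
  proof -
    have "c i \<le> K" unfolding K_def using that c(1) by (intro member_le_sum) (auto simp: less_imp_le)
    then have "c i *\<^sub>R (f ^^ Suc i) u \<preceq> K *\<^sub>R (f ^^ Suc i) u"
      using funpow_interior[OF u(1)] by (intro le_scaleR_left interior_mem)
    then show ?thesis using c(2) le_trans by blast
  qed
  have "K \<ge> 0" unfolding K_def using c(1) by (intro sum_nonneg) (auto simp: less_imp_le)
  have "(\<lambda>n. \<epsilon> n * K) \<longlonglongrightarrow> 0 * K" by (intro tendsto_intros \<epsilon>)
  then have "\<forall>\<^sub>F n in sequentially. \<epsilon> n * K < \<eta>" using \<eta>(1) by (intro order_tendstoD) auto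
  then show ?thesis
  proof eventually_elim
    case (elim n)
    have "u \<noteq> 0" using u(2) by auto
    then have "v n \<noteq> 0" using v[of n] zero_notin_interior[OF interior_mem[OF u(1)]] by auto
    then obtain \<tau> where \<tau>: "\<tau> > 0" "v n \<preceq> \<tau> *\<^sub>R u" "\<And>t. v n \<preceq> t *\<^sub>R u \<Longrightarrow> \<tau> \<le> t"
      using least_dominating_factor[OF interior_mem[OF v] _ u(1), of n] by blast
    have base: "0 \<le> 1 + \<epsilon> n * K" using \<epsilon>(1)[of n] \<open>K \<ge> 0\<close> by simp
    define \<theta> where "\<theta> = (1 + \<epsilon> n * K) ^ k * ((1 + \<eta>) ^ k)\<^sup>2"
    have "\<mu> n ^ k *\<^sub>R v n \<preceq> (\<tau> * (1 + \<epsilon> n * K) ^ k) *\<^sub>R (f ^^ k) u"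
      using perturbed_eigenvector_power_le[OF N u(1) v eig pos \<epsilon>(1) \<tau>(1) \<open>K \<ge> 0\<close> \<tau>(2) K, of k k]
      by blast
    also have "\<dots> \<preceq> (\<tau> * (1 + \<epsilon> n * K) ^ k) *\<^sub>R (((1 + \<eta>) ^ k)\<^sup>2 *\<^sub>R u)"
      using \<tau>(1) base k(2) by (intro le_scaleR) auto
    finally have "(1 / \<mu> n ^ k) *\<^sub>R (\<mu> n ^ k *\<^sub>R v n) \<preceq> (1 / \<mu> n ^ k) *\<^sub>R ((\<tau> * \<theta>) *\<^sub>R u)"
      using pos[of n] by (intro le_scaleR) (auto simp: \<theta>_def mult.assoc less_imp_le)
    then have "v n \<preceq> (\<tau> * \<theta> / \<mu> n ^ k) *\<^sub>R u" using pos[of n] by simp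
    then have "\<tau> \<le> \<tau> * \<theta> / \<mu> n ^ k" by (rule \<tau>(3))
    then have "\<mu> n ^ k \<le> \<theta>" using \<tau>(1) pos[of n] by (simp add: field_simps)
    also have "\<theta> \<le> (1 + \<eta>) ^ k * ((1 + \<eta>) ^ k)\<^sup>2"
      unfolding \<theta>_def using base elim by (intro mult_right_mono power_mono) auto
    also have "\<dots> = a ^ k"
      by (simp flip: \<eta>(2) power_mult power_add)
    finally show "\<mu> n \<le> a" using power_mono_iff[of "\<mu> n" a k] pos[of n] \<open>a > 1\<close> k(1) by simp
  qed
qed

section \<open>Normalised orbits\<close>

lemma normalized_funpow:
  assumes q: "\<forall>x\<in>interior C. q x > 0" "homogeneous_on (interior C) q"
    and g: "\<forall>x\<in>{x \<in> interior C. q x = 1}. g x = f x /\<^sub>R q (f x)"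
    and z: "z \<in> interior C" "q z = (1::real)"
  shows "(g ^^ k) z = (f ^^ k) z /\<^sub>R q ((f ^^ k) z)"
proof (induction k)
  case 0
  then show ?case using z by simp
next
  case (Suc k)
  define y where "y = (f ^^ k) z"
  have y: "y \<in> interior C" "f y \<in> interior C"
    using funpow_interior[OF z(1), of k] maps_interior by (auto simp: y_def)
  have qy: "q y > 0" "q (f y) > 0" using q(1) y by auto
  have q_scale: "q (inverse (q y) *\<^sub>R x) = inverse (q y) * q x" if "x \<in> interior C" for x
    using q(2) qy that by (simp add: homogeneous_on_def)
  have "f (y /\<^sub>R q y) = f y /\<^sub>R q y"
    using homogeneous y qy by (simp add: homogeneous_on_def)
  moreover have "y /\<^sub>R q y \<in> {x \<in> interior C. q x = 1}"
    using y qy by (auto simp: q_scale intro: interior_scaleR_mem)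
  ultimately have "g (y /\<^sub>R q y) = f y /\<^sub>R q (f y)"
    using g qy y by (simp add: q_scale)
  then show ?case using Suc by (simp add: y_def)
qed

lemma funpow_norm_at_top:
  assumes normal: "normal_cone C" and x: "x \<in> interior C" and z: "z \<in> interior C"
    and lim: "filterlim (\<lambda>k. norm ((f ^^ k) x)) at_top sequentially"
  shows "filterlim (\<lambda>k. norm ((f ^^ k) z)) at_top sequentially"
proof -
  obtain \<kappa> where \<kappa>: "\<kappa> \<ge> 0" "\<And>x y. 0 \<preceq> x \<Longrightarrow> x \<preceq> y \<Longrightarrow> norm x \<le> \<kappa> * norm y"
    using normal by (auto simp: normal_cone_def)
  obtain c where c: "c > 0" "x \<preceq> c *\<^sub>R z" using le_scaleR_interior[OF z] by blast
  define d where "d = 1 / (\<kappa> * c + 1)"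
  have d: "d > 0" unfolding d_def using \<kappa>(1) c(1) by (simp add: add_nonneg_pos)
  have "d * norm ((f ^^ k) x) \<le> norm ((f ^^ k) z)" for k
  proof -
    have "norm ((f ^^ k) x) \<le> \<kappa> * norm (c *\<^sub>R (f ^^ k) z)"
      using \<kappa>(2) funpow_le_scaleR[OF x z c] zero_le interior_mem funpow_interior[OF x] by blast
    also have "\<dots> \<le> (\<kappa> * c + 1) * norm ((f ^^ k) z)" using c(1) by (simp add: algebra_simps)
    finally have "norm ((f ^^ k) x) \<le> (\<kappa> * c + 1) * norm ((f ^^ k) z)" .
    then show ?thesis using \<kappa>(1) c(1) by (simp add: d_def divide_le_eq add_nonneg_pos mult.commute)
  qed
  moreover have "filterlim (\<lambda>k. d * norm ((f ^^ k) x)) at_top sequentially"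
    using d lim by (intro filterlim_tendsto_pos_mult_at_top[OF tendsto_const])
  ultimately show ?thesis by (auto intro: filterlim_at_top_mono)
qed

lemma norm_le_mult_gauge:
  fixes q :: "'a \<Rightarrow> real"
  assumes q: "\<forall>x\<in>interior C. q x > 0" "homogeneous_on (interior C) q"
    and bdd: "bounded {x \<in> interior C. q x = 1}"
  obtains B where "B > 0" "\<And>x. x \<in> interior C \<Longrightarrow> norm x \<le> B * q x"
proof -
  obtain B where B: "B > 0" "\<And>x. x \<in> interior C \<Longrightarrow> q x = 1 \<Longrightarrow> norm x \<le> B"
    using bdd by (auto simp: bounded_pos)
  have "norm x \<le> B * q x" if x: "x \<in> interior C" for x
  proof -
    have qx: "q x > 0" using q x by auto
    then have "q (x /\<^sub>R q x) = 1" using q(2) x by (simp add: homogeneous_on_def)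
    then have "norm (x /\<^sub>R q x) \<le> B"
      using B(2)[of "x /\<^sub>R q x"] interior_scaleR_mem[OF x, of "inverse (q x)"] qx by simp
    then show ?thesis using qx by (simp add: field_simps)
  qed
  with B(1) show thesis using that by blast
qed

section \<open>The asymptotically negligible part of the cone\<close>

text \<open>
  The elements \<open>y\<close> of the cone such that, for every \<open>\<delta> > 0\<close>, eventually \<open>y \<le> \<delta> w\<^sub>n\<close>. When all \<open>w\<^sub>n\<close>
  are interior points, this is the zero set in \<open>C\<close> of \<open>y \<mapsto> limsup M(y / w\<^sub>n)\<close>; the definition
  by inequalities avoids suprema and infima.
\<close>

definition negligible_part :: "(nat \<Rightarrow> 'a) \<Rightarrow> 'a set" where
  "negligible_part w = {y \<in> C. \<forall>\<delta>>0. \<forall>\<^sub>F n in sequentially. y \<preceq> \<delta> *\<^sub>R w n}"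

lemma convex_negligible_part: "convex (negligible_part w)"
proof (rule convexI)
  fix x y and a b :: real
  assume x: "x \<in> negligible_part w" and y: "y \<in> negligible_part w"
    and ab: "0 \<le> a" "0 \<le> b" "a + b = 1"
  have "\<forall>\<^sub>F n in sequentially. a *\<^sub>R x + b *\<^sub>R y \<preceq> \<delta> *\<^sub>R w n" if "\<delta> > 0" for \<delta>
  proof -
    have "\<forall>\<^sub>F n in sequentially. x \<preceq> \<delta> *\<^sub>R w n" "\<forall>\<^sub>F n in sequentially. y \<preceq> \<delta> *\<^sub>R w n"
      using x y that by (auto simp: negligible_part_def)
    then show ?thesis
    proof eventually_elim
      case (elim n)
      have "a *\<^sub>R x + b *\<^sub>R y \<preceq> a *\<^sub>R (\<delta> *\<^sub>R w n) + b *\<^sub>R (\<delta> *\<^sub>R w n)"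
        using elim ab by (intro le_add le_scaleR)
      also have "\<dots> = \<delta> *\<^sub>R w n" using ab(3) by (simp flip: scaleR_add_left distrib_right)
      finally show ?case .
    qed
  qed
  then show "a *\<^sub>R x + b *\<^sub>R y \<in> negligible_part w"
    using x y ab by (auto simp: negligible_part_def intro: add_mem scaleR_mem)
qed

lemma negligible_part_subset_frontier:
  assumes u: "u \<in> interior C" and least: "\<And>n t. u \<preceq> t *\<^sub>R w n \<Longrightarrow> 1 \<le> t"
  shows "negligible_part w \<subseteq> frontier C"
proof
  fix y assume y: "y \<in> negligible_part w"
  have "y \<notin> interior C"
  proof
    assume "y \<in> interior C"
    then obtain s where s: "s > 0" "u \<preceq> s *\<^sub>R y" using le_scaleR_interior by blast
    have "\<forall>\<^sub>F n in sequentially. y \<preceq> (1 / (2 * s)) *\<^sub>R w n"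
      using y s(1) by (simp add: negligible_part_def)
    then obtain n where "y \<preceq> (1 / (2 * s)) *\<^sub>R w n"
      by (auto simp: eventually_sequentially)
    then have "s *\<^sub>R y \<preceq> s *\<^sub>R ((1 / (2 * s)) *\<^sub>R w n)" using s(1) by (intro le_scaleR) auto
    then have "u \<preceq> (1 / 2) *\<^sub>R w n" using s le_trans by fastforce
    then show False using least by fastforce
  qed
  then show "y \<in> frontier C"
    using y closed_cone by (auto simp: frontier_def negligible_part_def)
qed

lemma omega_limit_subset_negligible_part:
  assumes u: "u \<in> interior C" and w: "\<And>n. w n \<in> interior C" "\<And>n. u \<preceq> w n"
    and \<mu>: "\<And>n. \<mu> n > 0" "\<And>n. f (w n) \<preceq> \<mu> n *\<^sub>R w n"
      "\<And>a. a > 1 \<Longrightarrow> \<forall>\<^sub>F n in sequentially. \<mu> n \<le> a"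
    and z: "z \<in> interior C"
    and g: "\<And>k. (g ^^ k) z = (f ^^ k) z /\<^sub>R Q k" and Q: "filterlim Q at_top sequentially"
  shows "omega_limit g z \<subseteq> negligible_part w"
proof
  fix y assume "y \<in> omega_limit g z"
  then obtain \<kappa> where \<kappa>: "strict_mono \<kappa>" "(\<lambda>i. (g ^^ \<kappa> i) z) \<longlonglongrightarrow> y"
    by (auto simp: omega_limit_def)
  have Q\<kappa>: "filterlim (\<lambda>i. Q (\<kappa> i)) at_top sequentially"
    using filterlim_compose[OF Q filterlim_subseq[OF \<kappa>(1)]] .
  obtain b where b: "b > 0" "z \<preceq> b *\<^sub>R u" using le_scaleR_interior[OF u] by blast
  obtain \<rho> where \<rho>: "\<rho> > 0" "\<And>x. x \<preceq> (norm x / \<rho>) *\<^sub>R u"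
    using interior_order_unit[OF u] by blast
  have "\<forall>\<^sub>F i in sequentially. (g ^^ \<kappa> i) z \<in> C"
    using filterlim_at_top_dense[THEN iffD1, OF Q\<kappa>, rule_format, of 0]
  proof eventually_elim
    case (elim i)
    then show ?case unfolding g using funpow_interior[OF z] by (intro scaleR_mem interior_mem) auto
  qed
  then have "y \<in> C" using closed_cone \<kappa>(2) by (intro Lim_in_closed_set) auto
  moreover have "\<forall>\<^sub>F n in sequentially. y \<preceq> \<delta> *\<^sub>R w n" if "\<delta> > 0" for \<delta>
  proof -
    have "\<forall>\<^sub>F i in sequentially. dist ((g ^^ \<kappa> i) z) y < \<rho> * \<delta> / 2"
      using \<kappa>(2) \<rho>(1) that by (intro tendstoD) auto
    moreover have "\<forall>\<^sub>F i in sequentially. Q (\<kappa> i) > 4 * b / \<delta>"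
      using Q\<kappa> by (simp add: filterlim_at_top_dense)
    ultimately have "\<forall>\<^sub>F i in sequentially.
        dist ((g ^^ \<kappa> i) z) y < \<rho> * \<delta> / 2 \<and> Q (\<kappa> i) > 4 * b / \<delta>"
      by eventually_elim simp
    then obtain k where k: "dist ((g ^^ k) z) y < \<rho> * \<delta> / 2" "Q k > 4 * b / \<delta>"
      by (auto simp: eventually_sequentially)
    have Qpos: "Q k > 0" using k(2) b(1) that by (smt (verit) divide_pos_pos)
    have "norm (y - (g ^^ k) z) / \<rho> \<le> \<delta> / 2"
      using k(1) \<rho>(1) by (simp add: dist_norm norm_minus_commute field_simps)
    then have "(norm (y - (g ^^ k) z) / \<rho>) *\<^sub>R u \<preceq> (\<delta> / 2) *\<^sub>R u"
      using u by (intro le_scaleR_left interior_mem)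
    then have near: "y - (g ^^ k) z \<preceq> (\<delta> / 2) *\<^sub>R u" using \<rho>(2) le_trans by blast
    \<comment> \<open>The bound \<open>root (Suc k) 2\<close> on \<open>\<mu>\<^sub>n\<close> gives \<open>\<mu>\<^sub>n\<^sup>k \<le> 2\<close>; \<open>Suc k\<close> covers the case \<open>k = 0\<close>.\<close>
    have "root (Suc k) 2 > 1" by simp
    then have "\<forall>\<^sub>F n in sequentially. \<mu> n \<le> root (Suc k) 2" by (rule \<mu>(3))
    then show ?thesis
    proof eventually_elim
      case (elim n)
      have "\<mu> n ^ k \<le> root (Suc k) 2 ^ k" using elim \<mu>(1)[of n] by (intro power_mono) auto
      also have "\<dots> \<le> root (Suc k) 2 ^ Suc k" by (intro power_increasing) auto
      also have "\<dots> = 2" by (rule real_root_pow_pos2) auto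
      finally have \<mu>2: "\<mu> n ^ k \<le> 2" .
      have wC: "w n \<in> C" using w(1) interior_mem by blast
      have "z \<preceq> b *\<^sub>R w n" using b le_scaleR[OF w(2)] le_trans by (meson less_imp_le)
      then have "(f ^^ k) z \<preceq> b *\<^sub>R (f ^^ k) (w n)" using b w z by (intro funpow_le_scaleR)
      also have "\<dots> \<preceq> b *\<^sub>R (\<mu> n ^ k *\<^sub>R w n)"
        using b w \<mu> by (intro le_scaleR funpow_supereigenvector) auto
      also have "\<dots> \<preceq> (b * 2) *\<^sub>R w n"
        using \<mu>2 b(1) wC by (simp add: le_scaleR_left)
      finally have "(1 / Q k) *\<^sub>R (f ^^ k) z \<preceq> (1 / Q k) *\<^sub>R ((b * 2) *\<^sub>R w n)"
        using Qpos by (intro le_scaleR) auto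
      then have "(g ^^ k) z \<preceq> (b * 2 / Q k) *\<^sub>R w n" by (simp add: g divide_inverse mult.commute)
      also have "\<dots> \<preceq> (\<delta> / 2) *\<^sub>R w n"
        using k(2) Qpos that wC by (intro le_scaleR_left) (auto simp: field_simps)
      finally have "(g ^^ k) z \<preceq> (\<delta> / 2) *\<^sub>R w n" .
      moreover have "y - (g ^^ k) z \<preceq> (\<delta> / 2) *\<^sub>R w n"
        using near le_scaleR[OF w(2), of "\<delta> / 2"] that le_trans by fastforce
      ultimately have "(g ^^ k) z + (y - (g ^^ k) z) \<preceq> (\<delta> / 2) *\<^sub>R w n + (\<delta> / 2) *\<^sub>R w n"
        by (rule le_add)
      then show ?case by (simp flip: scaleR_add_left)
    qed
  qed
  ultimately show "y \<in> negligible_part w" by (simp add: negligible_part_def)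
qed

end

section \<open>A convex part of the boundary attracting all orbits\<close>

theorem theorem7p3:
  fixes C :: "'a::banach set"
    and f g :: "'a \<Rightarrow> 'a"
    and q N :: "'a \<Rightarrow> real"
    and u :: 'a
    and \<Sigma>\<^sub>0 :: "'a set"
  assumes "ordering_cone C" and "normal_cone C" and "closed C" and "interior C \<noteq> {}"
    and "f ` interior C \<subseteq> interior C"
    and "\<forall>x\<in>interior C. f x \<noteq> x"
    and "monotone_on (interior C) (cone_le C) (cone_le C) f"
    and "homogeneous_on (interior C) f"
    and "has_partial_spectral_radius C f 1"
    and "equivalent_norm N" and "monotone_norm C N"
    and "u \<in> interior C" and "norm u = 1"
    and "converging_approx_eigenvectors C N u f"
    and "\<forall>x\<in>interior C. q x > 0"
    and "continuous_on (interior C) q"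
    and "homogeneous_on (interior C) q"
    and "\<Sigma>\<^sub>0 = {x \<in> interior C. q x = 1}"
    and "bounded \<Sigma>\<^sub>0"
    and "\<forall>x\<in>\<Sigma>\<^sub>0. g x = f x /\<^sub>R q (f x)"
    and "\<exists>x\<^sub>0\<in>interior C.
           filterlim (\<lambda>k. norm ((f ^^ k) x\<^sub>0)) at_top sequentially \<and>
           compact (closure (forward_orbit g (x\<^sub>0 /\<^sub>R q x\<^sub>0)))"
  shows "\<exists>\<Omega>. convex \<Omega> \<and> \<Omega> \<subseteq> frontier C \<and> (\<forall>z\<in>\<Sigma>\<^sub>0. omega_limit g z \<subseteq> \<Omega>)"
proof -
  interpret homogeneous_monotone_map C f
    using assms by unfold_locales auto
  note u = \<open>u \<in> interior C\<close> \<open>norm u = 1\<close>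
  note q = \<open>\<forall>x\<in>interior C. q x > 0\<close> \<open>homogeneous_on (interior C) q\<close>
  have "u \<noteq> 0" using u by auto
  obtain \<epsilon> v where \<epsilon>: "\<And>n. \<epsilon> n > 0" "\<epsilon> \<longlonglongrightarrow> 0"
    and v: "\<And>n::nat. approx_eigenvector C N u f (\<epsilon> n) (v n)"
    using \<open>converging_approx_eigenvectors C N u f\<close>
    unfolding converging_approx_eigenvectors_def by metis
  have vC: "\<And>n. v n \<in> interior C" and Nv: "\<And>n. N (v n) = 1"
    using v by (auto simp: approx_eigenvector_def)
  obtain \<mu> where \<mu>: "\<And>n. perturbed_map N u f (\<epsilon> n) (v n) = \<mu> n *\<^sub>R v n"
    using v unfolding approx_eigenvector_def by metis
  have \<mu>_pos: "\<mu> n > 0" for n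
    using perturbed_eigenvalue_pos[OF u(1) \<open>u \<noteq> 0\<close> vC Nv \<epsilon>(1) \<mu>] .
  have \<mu>_le: "\<forall>\<^sub>F n in sequentially. \<mu> n \<le> a" if "a > 1" for a
    using eventually_eigenvalue_le[OF \<open>normal_cone C\<close> \<open>equivalent_norm N\<close> \<open>monotone_norm C N\<close> u
        \<open>has_partial_spectral_radius C f 1\<close> \<epsilon> vC \<mu> \<mu>_pos that] .
  have f_v: "f (v n) \<preceq> \<mu> n *\<^sub>R v n" for n
    using \<mu>[of n] Nv[of n] scaleR_mem[OF interior_mem[OF u(1)], of "\<epsilon> n"] \<epsilon>(1)[of n]
    by (simp add: cone_le_def perturbed_map_def flip: \<mu>)
  \<comment> \<open>Normalise so that \<open>u \<le> w\<^sub>n\<close>, with \<open>1\<close> as the least admissible factor.\<close>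
  have "\<exists>c>0. u \<preceq> c *\<^sub>R v n \<and> (\<forall>t. u \<preceq> t *\<^sub>R v n \<longrightarrow> c \<le> t)" for n
    using least_dominating_factor[OF interior_mem[OF u(1)] \<open>u \<noteq> 0\<close> vC[of n]] by metis
  then obtain c where c: "\<And>n. c n > 0" "\<And>n. u \<preceq> c n *\<^sub>R v n"
    "\<And>n t. u \<preceq> t *\<^sub>R v n \<Longrightarrow> c n \<le> t"
    by metis
  define w where "w n = c n *\<^sub>R v n" for n
  have wC: "w n \<in> interior C" for n
    using vC c(1) by (simp add: w_def interior_scaleR_mem)
  have f_w: "f (w n) \<preceq> \<mu> n *\<^sub>R w n" for n
    using le_scaleR[OF f_v, of "c n" n] c(1)[of n] funpow_scaleR[OF vC c(1), of 1 n n]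
    by (simp add: w_def mult.commute)
  have "1 \<le> t" if "u \<preceq> t *\<^sub>R w n" for n t
    using c(3)[of "t * c n" n] c(1)[of n] that by (simp add: w_def)
  then have "negligible_part w \<subseteq> frontier C"
    using negligible_part_subset_frontier u(1) by blast
  moreover have "omega_limit g z \<subseteq> negligible_part w" if "z \<in> \<Sigma>\<^sub>0" for z
  proof -
    have z: "z \<in> interior C" "q z = 1" using that \<open>\<Sigma>\<^sub>0 = _\<close> by auto
    have g: "(g ^^ k) z = (f ^^ k) z /\<^sub>R q ((f ^^ k) z)" for k
      using assms z by (intro normalized_funpow) auto
    obtain B where B: "B > 0" "\<And>x. x \<in> interior C \<Longrightarrow> norm x \<le> B * q x"
      using norm_le_mult_gauge[OF q] \<open>bounded \<Sigma>\<^sub>0\<close> \<open>\<Sigma>\<^sub>0 = _\<close> by auto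
    obtain x where "x \<in> interior C" "filterlim (\<lambda>k. norm ((f ^^ k) x)) at_top sequentially"
      using \<open>\<exists>x\<^sub>0\<in>interior C. _ \<and> _\<close> by blast
    then have "filterlim (\<lambda>k. norm ((f ^^ k) z)) at_top sequentially"
      using funpow_norm_at_top \<open>normal_cone C\<close> z(1) by blast
    then have "filterlim (\<lambda>k. (1 / B) * norm ((f ^^ k) z)) at_top sequentially"
      using B(1) by (intro filterlim_tendsto_pos_mult_at_top[OF tendsto_const]) auto
    moreover have "(1 / B) * norm ((f ^^ k) z) \<le> q ((f ^^ k) z)" for k
      using B(2)[OF funpow_interior[OF z(1)], of k] B(1) by (simp add: field_simps)
    ultimately have "filterlim (\<lambda>k. q ((f ^^ k) z)) at_top sequentially"
      by (auto intro: filterlim_at_top_mono)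
    then show ?thesis
      using omega_limit_subset_negligible_part[OF u(1) wC _ \<mu>_pos f_w \<mu>_le z(1) g]
      using c(2) by (simp add: w_def [abs_def])
  qed
  ultimately show ?thesis using convex_negligible_part by blast
qed

end
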